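(* For integers $W_0,W_1,\dots,W_5$ consider the rational numbers $$\begin{aligned} a&=\frac{3W_0+2W_1-7W_2-W_3+4W_4-W_5}{5}, & b&=\frac{-3W_0-2W_1-3W_2+6W_3+6W_4-4W_5}{5},\\ c&=\frac{-4W_0-W_1+11W_2-2W_3-7W_4+3W_5}{5}, & d&=-2W_1+W_2+2W_3-W_4,\\ e&=\frac{W_0+3W_1+W_2-3W_3-W_4+W_5}{2}, & f&=\frac{W_0+W_1-3W_2-W_3+3W_4-W_5}{2}. \end{aligned}\qquad( * )$$ (i) For all integers $W_0,\dots,W_5$, if $a,b,c,d,e,f$ are given by $( * )$, then the sequence $$w_n=(an+b)F_n+(cn+d)F_{n-1}+e+f(-1)^n\qquad(n\in\mathbb{Z})$$ is an integer sequence (i.e. $w_n\in\mathbb{Z}$ for all $n$) with initial values $w_i=W_i$ for $0\le i\le 5$. (ii) Conversely, if $a,b,c,d,e,f\in\mathbb{Q}$ are such that $w_n=(an+b)F_n+(cn+d)F_{n-1}+e+f(-1)^n$ is an integer for all $n\in\mathbb{Z}$, then $a,b,c,d,e,f$ are given by $( * )$ with the integers $W_i=w_i$ for $0\le i\le 5$.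
   Context: $(F_n)$ is the Fibonacci sequence: $F_0=0$, $F_1=1$, $F_n=F_{n-1}+F_{n-2}$, extended to negative indices by the same recurrence, so that $F_{-n}=(-1)^{n+1}F_n$ (in particular $F_{-1}=1$). *)

theory Defs
  imports Complex_Main "HOL-Number_Theory.Fib"
begin

text \<open>
  The library function \<open>fib\<close> has type \<open>nat \<Rightarrow> nat\<close>. The extension to all integers is defined by
  \<open>F(-n) = (-1)^(n+1) F(n)\<close>; the lemmas below show that it satisfies the Fibonacci recurrence at
  every integer and is the only such function with values \<open>0\<close> and \<open>1\<close> at \<open>0\<close> and \<open>1\<close>.
\<close>

definition fibz :: "int \<Rightarrow> int" where
  "fibz n = (if n \<ge> 0 then int (fib (nat n)) else (-1) ^ (nat (-n) + 1) * int (fib (nat (-n))))"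

lemma fibz_of_nat: "fibz (int n) = int (fib n)"
  by (simp add: fibz_def)

lemma fibz_uminus_of_nat: "fibz (- int n) = (-1) ^ (n + 1) * int (fib n)"
  by (cases n) (simp_all add: fibz_def nat_add_distrib)

lemma fibz_0: "fibz 0 = 0" and fibz_1: "fibz 1 = 1" and fibz_minus_1: "fibz (-1) = 1"
  by (simp_all add: fibz_def)

lemma fibz_rec: "fibz n = fibz (n - 1) + fibz (n - 2)"
proof -
  consider m where "n = int (m + 2)" | "n = 1" | m where "n = - int m"
  proof (cases "n \<ge> 2")
    case True
    then have "n = int (nat (n - 2) + 2)" by simp
    then show ?thesis using that(1) by blast
  next
    case False
    show ?thesis
    proof (cases "n = 1")
      case True
      then show ?thesis using that(2) by blast
    next
      case False
      with \<open>\<not> n \<ge> 2\<close> have "n = - int (nat (- n))" by simp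
      then show ?thesis using that(3) by blast
    qed
  qed
  then show ?thesis
  proof cases
    case (1 m)
    then have "n - 1 = int (m + 1)" "n - 2 = int m" by simp_all
    then have "fibz (n - 1) = int (fib (m + 1))" "fibz (n - 2) = int (fib m)"
      by (simp_all only: fibz_of_nat)
    moreover have "fibz n = int (fib (m + 2))" using 1 by (simp only: fibz_of_nat)
    ultimately show ?thesis by simp
  next
    case 2
    then show ?thesis by (simp add: fibz_def)
  next
    case (3 m)
    then have "n - 1 = - int (m + 1)" "n - 2 = - int (m + 2)" by simp_all
    then have "fibz (n - 1) = (-1) ^ (m + 2) * int (fib (m + 1))"
      "fibz (n - 2) = (-1) ^ (m + 3) * int (fib (m + 2))"
      by (simp_all only: fibz_uminus_of_nat) (simp_all add: power_add)
    moreover have "fibz n = (-1) ^ (m + 1) * int (fib m)"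
      using 3 by (simp only: fibz_uminus_of_nat)
    ultimately show ?thesis by (simp add: power_add algebra_simps)
  qed
qed

lemma fibz_unique:
  fixes g :: "int \<Rightarrow> int"
  assumes "g 0 = 0" and "g 1 = 1" and rec: "\<And>n. g n = g (n - 1) + g (n - 2)"
  shows "g = fibz"
proof -
  have up: "g (int m) = fibz (int m) \<and> g (int m + 1) = fibz (int m + 1)" for m
  proof (induction m)
    case 0
    then show ?case using assms(1,2) by (simp add: fibz_0 fibz_1)
  next
    case (Suc m)
    then show ?case
      using rec[of "int m + 2"] fibz_rec[of "int m + 2"] by (simp add: add.commute)
  qed
  have down: "g (- int m) = fibz (- int m) \<and> g (- int m + 1) = fibz (- int m + 1)" for m
  proof (induction m)
    case 0
    then show ?case using assms(1,2) by (simp add: fibz_0 fibz_1)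
  next
    case (Suc m)
    then show ?case
      using rec[of "- int m + 1"] fibz_rec[of "- int m + 1"] by (simp add: algebra_simps)
  qed
  have "g n = fibz n" for n
    using up down by (cases n rule: int_cases2) auto
  then show ?thesis by blast
qed

definition wseq :: "rat \<Rightarrow> rat \<Rightarrow> rat \<Rightarrow> rat \<Rightarrow> rat \<Rightarrow> rat \<Rightarrow> int \<Rightarrow> rat" where
  "wseq a b c d e f n =
     (a * of_int n + b) * of_int (fibz n) + (c * of_int n + d) * of_int (fibz (n - 1))
     + e + f * (-1) powi n"

definition coeffs_given_by ::
  "int \<Rightarrow> int \<Rightarrow> int \<Rightarrow> int \<Rightarrow> int \<Rightarrow> int \<Rightarrow> rat \<Rightarrow> rat \<Rightarrow> rat \<Rightarrow> rat \<Rightarrow> rat \<Rightarrow> rat \<Rightarrow> bool" where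
  "coeffs_given_by W0 W1 W2 W3 W4 W5 a b c d e f \<longleftrightarrow>
     a = of_int (3 * W0 + 2 * W1 - 7 * W2 - W3 + 4 * W4 - W5) / 5 \<and>
     b = of_int (- 3 * W0 - 2 * W1 - 3 * W2 + 6 * W3 + 6 * W4 - 4 * W5) / 5 \<and>
     c = of_int (- 4 * W0 - W1 + 11 * W2 - 2 * W3 - 7 * W4 + 3 * W5) / 5 \<and>
     d = of_int (- 2 * W1 + W2 + 2 * W3 - W4) \<and>
     e = of_int (W0 + 3 * W1 + W2 - 3 * W3 - W4 + W5) / 2 \<and>
     f = of_int (W0 + W1 - 3 * W2 - W3 + 3 * W4 - W5) / 2"

end

(* The characteristic polynomial (x^2 - x - 1)^2 (x^2 - 1) of the sequence is monic with constant
   term -1, so the order-6 recurrence has integer coefficients in both directions: integrality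
   at 0,...,5 spreads to all indices. The relation between the six coefficients and the first six
   values is an invertible linear system. *)

theory Submission
  imports Defs
begin

text \<open>Writing every shifted value in terms of \<open>fibz n\<close> and
  \<open>fibz (n - 1)\<close> turns identities between shifts of \<open>wseq\<close> into polynomial
  identities.\<close>

lemma fibz_shift:
  "fibz (n + 1) = fibz n + fibz (n - 1)"
  "fibz (n + 2) = 2 * fibz n + fibz (n - 1)"
  "fibz (n + 3) = 3 * fibz n + 2 * fibz (n - 1)"
  "fibz (n + 4) = 5 * fibz n + 3 * fibz (n - 1)"
  "fibz (n + 5) = 8 * fibz n + 5 * fibz (n - 1)"
  "fibz (n + 6) = 13 * fibz n + 8 * fibz (n - 1)"
  using fibz_rec[of "n + 1"] fibz_rec[of "n + 2"] fibz_rec[of "n + 3"]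
    fibz_rec[of "n + 4"] fibz_rec[of "n + 5"] fibz_rec[of "n + 6"]
  by (simp_all add: add.commute[of _ n])

text \<open>The coefficients come from x^6 - 2x^5 - 2x^4 + 4x^3 + 2x^2 - 2x - 1 = (x^2 - x - 1)^2
  (x^2 - 1). The squared factor accounts for the coefficients linear in n of the Fibonacci terms,
  and x^2 - 1 for \<open>e\<close> and the alternating term.\<close>

lemma wseq_recurrence:
  "wseq a b c d e f (n + 6) = 2 * wseq a b c d e f (n + 5) + 2 * wseq a b c d e f (n + 4)
     - 4 * wseq a b c d e f (n + 3) - 2 * wseq a b c d e f (n + 2)
     + 2 * wseq a b c d e f (n + 1) + wseq a b c d e f n"
  \<comment> \<open>The reversed \<open>add_diff_eq\<close> regroups n + k - 1 as n + (k - 1), so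
    that \<open>fibz_shift\<close> also applies to the second Fibonacci factor.\<close>
  by (simp add: wseq_def fibz_shift power_int_add add_diff_eq[symmetric])
    (simp add: algebra_simps)

lemma wseq_initial:
  "wseq a b c d e f 0 = d + e + f"
  "wseq a b c d e f 1 = a + b + e - f"
  "wseq a b c d e f 2 = 2 * a + b + 2 * c + d + e + f"
  "wseq a b c d e f 3 = 6 * a + 2 * b + 3 * c + d + e - f"
  "wseq a b c d e f 4 = 12 * a + 3 * b + 8 * c + 2 * d + e + f"
  "wseq a b c d e f 5 = 25 * a + 5 * b + 15 * c + 3 * d + e - f"
  using fibz_shift[of 0] by (simp_all add: wseq_def fibz_0 fibz_1 fibz_minus_1 algebra_simps)

text \<open>The formulas for the coefficients are the inverse of the 6 by 6 linear system in
  \<open>wseq_initial\<close>. Both halves of the theorem rest on this equivalence.\<close>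

lemma coeffs_given_by_iff:
  "coeffs_given_by W0 W1 W2 W3 W4 W5 a b c d e f \<longleftrightarrow>
     wseq a b c d e f 0 = of_int W0 \<and> wseq a b c d e f 1 = of_int W1 \<and>
     wseq a b c d e f 2 = of_int W2 \<and> wseq a b c d e f 3 = of_int W3 \<and>
     wseq a b c d e f 4 = of_int W4 \<and> wseq a b c d e f 5 = of_int W5"
  (is "?L \<longleftrightarrow> ?R")
proof
  show ?R if ?L
    using that by (simp add: coeffs_given_by_def wseq_initial field_simps)
next
  assume ?R
  then have W: "of_int W0 = d + e + f" "of_int W1 = a + b + e - f"
    "of_int W2 = 2 * a + b + 2 * c + d + e + f" "of_int W3 = 6 * a + 2 * b + 3 * c + d + e - f"
    "of_int W4 = 12 * a + 3 * b + 8 * c + 2 * d + e + f"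
    "of_int W5 = 25 * a + 5 * b + 15 * c + 3 * d + e - f"
    by (simp_all add: wseq_initial)
  \<comment> \<open>Once each \<open>W\<close> is replaced by its linear form, every formula
    collapses to the single coefficient it defines.\<close>
  show ?L
    unfolding coeffs_given_by_def by (simp add: W)
qed

lemma recurrence_Ints:
  fixes w :: "int \<Rightarrow> 'a::ring_1"
  assumes rec: "\<And>n. w (n + 6) = 2 * w (n + 5) + 2 * w (n + 4) - 4 * w (n + 3) - 2 * w (n + 2)
      + 2 * w (n + 1) + w n"
    and init: "w 0 \<in> \<int>" "w 1 \<in> \<int>" "w 2 \<in> \<int>" "w 3 \<in> \<int>" "w 4 \<in> \<int>" "w 5 \<in> \<int>"
  shows "w n \<in> \<int>"
proof -
  \<comment> \<open>A window of six consecutive values is what the recurrence needs to move one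
    place in either direction.\<close>
  have "w n \<in> \<int> \<and> w (n + 1) \<in> \<int> \<and> w (n + 2) \<in> \<int> \<and> w (n + 3) \<in> \<int> \<and> w (n + 4) \<in> \<int> \<and> w (n + 5) \<in> \<int>"
  proof (induction n rule: int_induct[where k = 0])
    case base
    then show ?case using init by simp
  next
    case (step1 i)
    then have "w (i + 6) \<in> \<int>"
      unfolding rec by (intro Ints_add Ints_diff Ints_mult Ints_numeral) auto
    with step1 show ?case by (simp add: add.assoc)
  next
    case (step2 i)
    \<comment> \<open>The lowest term of the recurrence has coefficient 1, so solving for it needs
      no division.\<close>
    have "w (i - 1) = w (i + 5) - 2 * w (i + 4) - 2 * w (i + 3) + 4 * w (i + 2) + 2 * w (i + 1)
        - 2 * w i"
      using rec[of "i - 1"] by (simp add: algebra_simps)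
    also have "\<dots> \<in> \<int>"
      using step2 by (intro Ints_add Ints_diff Ints_mult Ints_numeral) auto
    finally show ?case using step2 by (simp add: algebra_simps)
  qed
  then show ?thesis by blast
qed

theorem theorem4:
  shows "(\<forall>(W0::int) (W1::int) (W2::int) (W3::int) (W4::int) (W5::int)
            (a::rat) (b::rat) (c::rat) (d::rat) (e::rat) (f::rat).
            coeffs_given_by W0 W1 W2 W3 W4 W5 a b c d e f \<longrightarrow>
              (\<forall>n::int. wseq a b c d e f n \<in> \<int>) \<and>
              wseq a b c d e f 0 = of_int W0 \<and>
              wseq a b c d e f 1 = of_int W1 \<and>
              wseq a b c d e f 2 = of_int W2 \<and>
              wseq a b c d e f 3 = of_int W3 \<and>
              wseq a b c d e f 4 = of_int W4 \<and>
              wseq a b c d e f 5 = of_int W5)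
       \<and> (\<forall>(a::rat) (b::rat) (c::rat) (d::rat) (e::rat) (f::rat).
            (\<forall>n::int. wseq a b c d e f n \<in> \<int>) \<longrightarrow>
            (\<exists>(W0::int) (W1::int) (W2::int) (W3::int) (W4::int) (W5::int).
              of_int W0 = wseq a b c d e f 0 \<and>
              of_int W1 = wseq a b c d e f 1 \<and>
              of_int W2 = wseq a b c d e f 2 \<and>
              of_int W3 = wseq a b c d e f 3 \<and>
              of_int W4 = wseq a b c d e f 4 \<and>
              of_int W5 = wseq a b c d e f 5 \<and>
              coeffs_given_by W0 W1 W2 W3 W4 W5 a b c d e f))"
proof (rule conjI; intro allI impI)
  fix W0 W1 W2 W3 W4 W5 a b c d e f
  assume "coeffs_given_by W0 W1 W2 W3 W4 W5 a b c d e f"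
  then have init: "wseq a b c d e f 0 = of_int W0 \<and> wseq a b c d e f 1 = of_int W1 \<and>
     wseq a b c d e f 2 = of_int W2 \<and> wseq a b c d e f 3 = of_int W3 \<and>
     wseq a b c d e f 4 = of_int W4 \<and> wseq a b c d e f 5 = of_int W5"
    by (simp only: coeffs_given_by_iff)
  then have "wseq a b c d e f n \<in> \<int>" for n
    by (simp add: recurrence_Ints[of "wseq a b c d e f", OF wseq_recurrence])
  with init show "(\<forall>n. wseq a b c d e f n \<in> \<int>) \<and>
     wseq a b c d e f 0 = of_int W0 \<and> wseq a b c d e f 1 = of_int W1 \<and>
     wseq a b c d e f 2 = of_int W2 \<and> wseq a b c d e f 3 = of_int W3 \<and>
     wseq a b c d e f 4 = of_int W4 \<and> wseq a b c d e f 5 = of_int W5"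
    by blast
next
  fix a b c d e f
  assume "\<forall>n. wseq a b c d e f n \<in> \<int>"
  \<comment> \<open>The floors serve as the witnesses \<open>W0\<close> to \<open>W5\<close>. After
    \<open>coeffs_given_by_iff\<close> is unfolded, only these equations remain to be met.\<close>
  then have "wseq a b c d e f n = of_int \<lfloor>wseq a b c d e f n\<rfloor>" for n
    by simp
  then show "\<exists>W0 W1 W2 W3 W4 W5.
      of_int W0 = wseq a b c d e f 0 \<and> of_int W1 = wseq a b c d e f 1 \<and>
      of_int W2 = wseq a b c d e f 2 \<and> of_int W3 = wseq a b c d e f 3 \<and>
      of_int W4 = wseq a b c d e f 4 \<and> of_int W5 = wseq a b c d e f 5 \<and>
      coeffs_given_by W0 W1 W2 W3 W4 W5 a b c d e f"
    unfolding coeffs_given_by_iff by metis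
qed

end
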